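(* For $d=1$ and all integers $\delta\ge 1$, $\psi(1,\delta,\lambda)=\delta$. For all integers $d\ge 2$ and $\delta\ge 1$, $$\big(2d^2+2d\sqrt{d^2-d}-d\big)\delta-1\ \le\ \psi(d,\delta,\lambda)\ \le\ \big(2d^2+2d\sqrt{d^2-d}-d\big)\delta-1+\frac{d}{\delta\sqrt{d^2-d}-1},$$ where $\psi$ and $\lambda=\lambda(d,\delta)$ are as defined in the context.
   Context: For integers $d,\delta,p\ge 1$ with $p\ge\delta d$, define $$\psi(d,\delta,p):=\frac{\delta d^2(p-\delta+1)}{p-\delta d+1}+d(p-\delta+1)-1.$$ For $d\ge 2$, put $p_1:=\delta d-1+\lfloor\delta\sqrt{d^2-d}\rfloor$ and $p_2:=p_1+1$ (both are $\ge\delta d$), and define $\lambda:=p_1$ if $\psi(d,\delta,p_1)\le\psi(d,\delta,p_2)$, and $\lambda:=p_2$ if $\psi(d,\delta,p_2)<\psi(d,\delta,p_1)$. For $d=1$, put $\lambda:=\delta$. Thus $\lambda$ depends on $d$ and $\delta$. *)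

theory Defs
  imports Complex_Main
begin

text \<open>The mathematical domain of \<open>psi\<close> is \<open>d, \<delta>, p \<ge> 1\<close> and \<open>p \<ge> \<delta> * d\<close>, where the denominator is
  at least 1. All arguments are integers, so no subtraction truncates.\<close>

definition psi :: "int \<Rightarrow> int \<Rightarrow> int \<Rightarrow> real" where
  "psi d \<delta> p =
     of_int (\<delta> * d^2 * (p - \<delta> + 1)) / of_int (p - \<delta> * d + 1) + of_int (d * (p - \<delta> + 1)) - 1"

definition p1 :: "int \<Rightarrow> int \<Rightarrow> int" where
  "p1 d \<delta> = \<delta> * d - 1 + \<lfloor>of_int \<delta> * sqrt (of_int (d^2 - d))\<rfloor>"

definition p2 :: "int \<Rightarrow> int \<Rightarrow> int" where
  "p2 d \<delta> = p1 d \<delta> + 1"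

definition lam :: "int \<Rightarrow> int \<Rightarrow> int" where
  "lam d \<delta> =
     (if d = 1 then \<delta>
      else if psi d \<delta> (p1 d \<delta>) \<le> psi d \<delta> (p2 d \<delta>) then p1 d \<delta>
      else p2 d \<delta>)"

text \<open>The values of \<open>psi\<close> used in \<open>lam\<close>, and \<open>lam\<close> itself, lie in the domain of \<open>psi\<close>.\<close>

lemma p1_ge:
  assumes "d \<ge> 2" and "\<delta> \<ge> 1"
  shows "p1 d \<delta> \<ge> \<delta> * d"
proof -
  have "d * (d - 1) \<ge> 1 * 1"
    by (rule mult_mono) (use assms in auto)
  then have "d^2 - d \<ge> 1"
    by (simp add: power2_eq_square algebra_simps)
  then have "sqrt (of_int (d^2 - d)) \<ge> 1"
    by (metis of_int_1_le_iff real_sqrt_ge_1_iff)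
  then have "of_int \<delta> * sqrt (of_int (d^2 - d)) \<ge> 1 * 1"
    using assms by (intro mult_mono) auto
  then have "\<lfloor>of_int \<delta> * sqrt (of_int (d^2 - d))\<rfloor> \<ge> 1"
    by (simp add: le_floor_iff)
  then show ?thesis
    by (simp add: p1_def)
qed

lemma lam_ge:
  assumes "d \<ge> 1" and "\<delta> \<ge> 1"
  shows "lam d \<delta> \<ge> \<delta> * d"
  using p1_ge[of d \<delta>] assms by (auto simp: lam_def p2_def)

end

theory Submission
  imports Defs
begin

text \<open>Put \<open>q = p - \<delta> * d + 1\<close>, the denominator in \<open>psi\<close>, and \<open>x = \<delta> * sqrt (d^2 - d)\<close>. Division of
  the numerator by \<open>q\<close> turns \<open>psi d \<delta> p\<close> into an affine function of \<open>q + x^2 / q\<close>, and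
  \<open>q + x^2 / q = 2 * x + (q - x)^2 / q\<close>. So the claimed lower bound is the value of the formula
  at its real minimiser \<open>q = x\<close>, and the excess of \<open>psi\<close> over it is exactly \<open>d * (q - x)^2 / q\<close>
  (lemma \<open>psi_eq_min_plus_excess\<close>).

  The lower bound therefore holds for every \<open>p\<close> in the domain. For the upper bound, \<open>p1\<close> is the
  choice \<open>q = \<lfloor>x\<rfloor>\<close>, for which \<open>(q - x)^2 \<le> 1\<close> and \<open>q > x - 1\<close>; and \<open>lam\<close> does at least as well
  as \<open>p1\<close>.\<close>

lemma psi_eq_min_plus_excess:
  fixes d \<delta> p :: int
  assumes "d \<ge> 1" and "p \<ge> \<delta> * d"
  defines "x \<equiv> of_int \<delta> * sqrt (of_int d^2 - of_int d)"
    and "q \<equiv> of_int (p - \<delta> * d + 1)"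
  shows "psi d \<delta> p =
    (2 * of_int d^2 + 2 * of_int d * sqrt (of_int d^2 - of_int d) - of_int d) * of_int \<delta> - 1
      + of_int d * ((q - x)^2 / q)"
proof -
  define D E s :: real where "D = of_int d" and "E = of_int \<delta>" and "s = sqrt (D^2 - D)"
  have "1 \<le> D"
    using assms(1) by (simp add: D_def)
  then have s2: "s^2 = D^2 - D"
    by (simp add: s_def power2_eq_square)
  have q: "q > 0"
    using assms(2) unfolding q_def by (subst of_int_0_less_iff) simp
  have shift: "of_int (p - \<delta> + 1) = q + E * (D - 1)"
    by (simp add: q_def D_def E_def algebra_simps)
  have "psi d \<delta> p = E * D^2 * (q + E * (D - 1)) / q + D * (q + E * (D - 1)) - 1"
    unfolding psi_def of_int_mult of_int_power shift q_def[symmetric]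
    by (simp add: D_def E_def)
  also have "\<dots> = (2 * D^2 - D) * E - 1 + D * (q + E^2 * (D^2 - D) / q)"
    using q by (simp add: field_simps power2_eq_square)
  also have "\<dots> = (2 * D^2 + 2 * D * s - D) * E - 1 + D * ((q - E * s)^2 / q)"
    unfolding s2[symmetric] using q by (simp add: field_simps power2_eq_square)
  finally show ?thesis
    by (simp add: x_def D_def E_def s_def)
qed

lemma psi_lam_le_psi_p1:
  assumes "d \<ge> 2"
  shows "psi d \<delta> (lam d \<delta>) \<le> psi d \<delta> (p1 d \<delta>)"
  using assms by (auto simp: lam_def)

text \<open>The numerator is the square of a fractional part, hence at most 1, and the denominator
  exceeds \<open>x - 1 > 0\<close>. This is where the error term of the upper bound comes from.\<close>

lemma floor_excess_le:
  fixes x :: real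
  assumes "x > 1"
  shows "(of_int \<lfloor>x\<rfloor> - x)^2 / of_int \<lfloor>x\<rfloor> \<le> 1 / (x - 1)"
proof (rule frac_le)
  have "\<bar>of_int \<lfloor>x\<rfloor> - x\<bar> \<le> 1"
    by linarith
  then show "(of_int \<lfloor>x\<rfloor> - x)^2 \<le> 1"
    by (simp add: abs_square_le_1)
qed (use assms in linarith)+

theorem mainTheorem2:
  shows "(\<forall>\<delta>::int. \<delta> \<ge> 1 \<longrightarrow> psi 1 \<delta> (lam 1 \<delta>) = of_int \<delta>) \<and>
    (\<forall>d \<delta>::int. d \<ge> 2 \<and> \<delta> \<ge> 1 \<longrightarrow>
      (2 * of_int d^2 + 2 * of_int d * sqrt (of_int d^2 - of_int d) - of_int d) * of_int \<delta> - 1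
        \<le> psi d \<delta> (lam d \<delta>) \<and>
      psi d \<delta> (lam d \<delta>)
        \<le> (2 * of_int d^2 + 2 * of_int d * sqrt (of_int d^2 - of_int d) - of_int d) * of_int \<delta> - 1
          + of_int d / (of_int \<delta> * sqrt (of_int d^2 - of_int d) - 1))"
proof (intro conjI allI impI)
  fix \<delta> :: int
  show "psi 1 \<delta> (lam 1 \<delta>) = of_int \<delta>"
    by (simp add: psi_def lam_def)
next
  fix d \<delta> :: int
  assume "d \<ge> 2 \<and> \<delta> \<ge> 1"
  then have d: "d \<ge> 2" and \<delta>: "\<delta> \<ge> 1"
    by auto
  let ?s = "sqrt (of_int d^2 - of_int d)"
  let ?m = "(2 * of_int d^2 + 2 * of_int d * ?s - of_int d) * of_int \<delta> - 1 :: real"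
  define x where "x = of_int \<delta> * ?s"
  have dom: "lam d \<delta> \<ge> \<delta> * d"
    using lam_ge d \<delta> by simp
  then show "?m \<le> psi d \<delta> (lam d \<delta>)"
    using d by (subst psi_eq_min_plus_excess) (auto intro!: mult_nonneg_nonneg divide_nonneg_nonneg
        simp flip: of_int_mult)
  have "2 * 1 \<le> d * (d - 1)"
    by (rule mult_mono) (use d in auto)
  then have "1 < d^2 - d"
    by (simp add: power2_eq_square algebra_simps)
  then have "1 < (of_int (d^2 - d) :: real)"
    by (subst of_int_1_less_iff)
  then have "1 < ?s"
    by simp
  also have "?s \<le> x"
    using mult_right_mono[of 1 "of_int \<delta>" ?s] \<delta> less_imp_le[OF less_trans[OF zero_less_one \<open>1 < ?s\<close>]]
    unfolding x_def by linarith
  finally have "x > 1" .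
  have q: "of_int (p1 d \<delta> - \<delta> * d + 1) = (of_int \<lfloor>x\<rfloor> :: real)"
    by (simp add: p1_def x_def)
  have "psi d \<delta> (lam d \<delta>) \<le> psi d \<delta> (p1 d \<delta>)"
    using d by (rule psi_lam_le_psi_p1)
  also have "\<dots> = ?m + of_int d * ((of_int \<lfloor>x\<rfloor> - x)^2 / of_int \<lfloor>x\<rfloor>)"
    using psi_eq_min_plus_excess[of d \<delta> "p1 d \<delta>"] p1_ge[OF d \<delta>] d
    unfolding q x_def[symmetric] by simp
  also have "\<dots> \<le> ?m + of_int d * (1 / (x - 1))"
    using floor_excess_le[OF \<open>x > 1\<close>] d by (intro add_left_mono mult_left_mono) auto
  finally show "psi d \<delta> (lam d \<delta>) \<le> ?m + of_int d / (of_int \<delta> * ?s - 1)"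
    by (simp add: x_def)
qed

end
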